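(* Let $m \ge 1$ and $0 \leq i \leq m$. Let $\frac{r}{s} > \frac{a}{b} \geq 1$ be rational numbers, and write $r^q_{i,m}\left(\frac{r}{s}\right) = \frac{\mathcal{R}(q)}{\mathcal{S}(q)}$ and $r^q_{i,m}\left(\frac{a}{b}\right) = \frac{\mathcal{A}(q)}{\mathcal{B}(q)}$, where $\mathcal{R}(q) = \Omega_m^{m+1-i,1}(\mathcal{G}(r/s),q)$, $\mathcal{S}(q) = \Omega_m^{m+1,1}(\mathcal{G}(r/s),q)$, $\mathcal{A}(q) = \Omega_m^{m+1-i,1}(\mathcal{G}(a/b),q)$, $\mathcal{B}(q) = \Omega_m^{m+1,1}(\mathcal{G}(a/b),q)$. Then $\mathcal{R}(q)\mathcal{B}(q) - \mathcal{A}(q)\mathcal{S}(q)$ is a polynomial with positive (i.e. nonnegative) integer coefficients.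
   Context: Border strip: for positive integers $a_1,\dots,a_n$, $\mathcal{G}[a_1,\dots,a_n]$ consists of unit boxes $b_1,\dots,b_N$, $N=a_1+\cdots+a_n-1$. If $n=1$ it is a vertical column of $a_1-1$ boxes indexed bottom to top. If $n\ge 2$, each $b_{t+1}$ is directly above or directly right of $b_t$, with step sequence: $a_1-1$ up, $a_2$ right, $a_3$ up, $a_4$ right, ..., alternating, ending with $a_n-1$ steps (right if $n$ even, up if $n$ odd). For a rational $x\ge 1$ with continued fraction $[a_1,\dots,a_n]$, $\mathcal{G}(x) := \mathcal{G}[a_1,\dots,a_n]$ (independent of the choice of expansion). A $P$-partition with parts at most $m$ is a map $\sigma$ from boxes to $\{0,\dots,m\}$ weakly increasing along rows left to right and along columns top to bottom; its weight is the sum of its values. For $1\le i,j\le m+1$, $\Omega_m^{ij}(\mathcal{G},q) = \sum_\sigma q^{\mathrm{wt}(\sigma)}$ over such $\sigma$ with $\sigma(b_1)\le m+1-i$ and $\sigma(b_N) \le m+1-j$. The higher $q$-continued fraction is $r^q_{i,m}(x) := \Omega_m^{m+1-i,1}(\mathcal{G}(x),q)/\Omega_m^{m+1,1}(\mathcal{G}(x),q)$. *)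

theory Defs
  imports
    Complex_Main
    "HOL-Library.FuncSet"
    "HOL-Computational_Algebra.Polynomial"
    "HOL-Computational_Algebra.Fraction_Field"
begin

section \<open>Border strips\<close>

text \<open>The pair \<open>(x, y)\<close> is the unit box in column \<open>x\<close> (counted from the left) and row \<open>y\<close>
  (counted from the bottom). A border strip is the list \<open>[b\<^sub>1, \<dots>, b\<^sub>N]\<close> of its boxes.\<close>

type_synonym box = "nat \<times> nat"

datatype step = Up | Rgt

fun move :: "step \<Rightarrow> box \<Rightarrow> box" where
  "move Up (x, y) = (x, Suc y)"
| "move Rgt (x, y) = (Suc x, y)"

fun walk :: "box \<Rightarrow> step list \<Rightarrow> box list" where
  "walk b [] = [b]"
| "walk b (s # ss) = b # walk (move s b) ss"

text \<open>For \<open>as = [a\<^sub>1, \<dots>, a\<^sub>n]\<close> with \<open>n \<ge> 2\<close>; position \<open>t\<close> holds \<open>a\<close> with index \<open>t + 1\<close>, so the steps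
  go up for even \<open>t\<close>.\<close>

definition border_steps :: "nat list \<Rightarrow> step list" where
  "border_steps as = concat (map
     (\<lambda>t. replicate (if t = 0 \<or> Suc t = length as then as ! t - 1 else as ! t)
            (if even t then Up else Rgt))
     [0..<length as])"

definition border_strip :: "nat list \<Rightarrow> box list" where
  "border_strip as =
     (if length as = 1 then map (\<lambda>k. (0, k)) [0..<as ! 0 - 1]
      else walk (0, 0) (border_steps as))"

fun cf_value :: "nat list \<Rightarrow> rat" where
  "cf_value [] = 0"
| "cf_value [a] = of_nat a"
| "cf_value (a # b # as) = of_nat a + 1 / cf_value (b # as)"

definition is_cf :: "rat \<Rightarrow> nat list \<Rightarrow> bool" where
  "is_cf x as \<longleftrightarrow> as \<noteq> [] \<and> (\<forall>a\<in>set as. 0 < a) \<and> cf_value as = x"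

text \<open>Every rational \<open>x \<ge> 1\<close> has an expansion, and the strip does not depend on the expansion
  chosen: see \<open>is_cf_exists\<close> and \<open>border_strip_of_eq\<close> below.\<close>

definition border_strip_of :: "rat \<Rightarrow> box list" where
  "border_strip_of x = border_strip (SOME as. is_cf x as)"

section \<open>\<open>P\<close>-partitions and higher continued fractions\<close>

definition p_partitions :: "nat \<Rightarrow> box set \<Rightarrow> (box \<Rightarrow> nat) set" where
  "p_partitions m G = {\<sigma> \<in> G \<rightarrow>\<^sub>E {0..m}.
     (\<forall>x x' y. (x, y) \<in> G \<and> (x', y) \<in> G \<and> x \<le> x' \<longrightarrow> \<sigma> (x, y) \<le> \<sigma> (x', y)) \<and>
     (\<forall>x y y'. (x, y) \<in> G \<and> (x, y') \<in> G \<and> y \<le> y' \<longrightarrow> \<sigma> (x, y') \<le> \<sigma> (x, y))}"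

text \<open>Intended for \<open>1 \<le> i, j \<le> m + 1\<close>, where the subtractions do not truncate. The empty strip,
  which arises only for \<open>x = 1\<close>, has no first or last box; there both bounds are vacuous and the
  value is \<open>1\<close>.\<close>

definition Omega :: "nat \<Rightarrow> nat \<Rightarrow> nat \<Rightarrow> box list \<Rightarrow> int poly" where
  "Omega m i j bs =
     (\<Sum>\<sigma> \<in> {\<sigma> \<in> p_partitions m (set bs).
              bs \<noteq> [] \<longrightarrow> \<sigma> (hd bs) \<le> m + 1 - i \<and> \<sigma> (last bs) \<le> m + 1 - j}.
        monom 1 (\<Sum>b\<in>set bs. \<sigma> b))"

definition higher_qcf :: "nat \<Rightarrow> nat \<Rightarrow> rat \<Rightarrow> int poly fract" where
  "higher_qcf i m x =
     Fraction_Field.Fract (Omega m (m + 1 - i) 1 (border_strip_of x))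
                          (Omega m (m + 1) 1 (border_strip_of x))"

section \<open>Well-definedness\<close>

lemma cf_value_ge_1:
  assumes "as \<noteq> []" "\<forall>a\<in>set as. 0 < a"
  shows "1 \<le> cf_value as"
  using assms
proof (induction as rule: cf_value.induct)
  case (3 a b as)
  then have "1 \<le> cf_value (b # as)" by simp
  moreover have "(1::rat) \<le> of_nat a" using 3 by (simp add: Suc_le_eq)
  ultimately show ?case by (simp add: add_increasing2)
qed (auto simp: Suc_le_eq)

lemma cf_value_Cons:
  assumes "as \<noteq> []"
  shows "cf_value (a # as) = of_nat a + 1 / cf_value as"
  using assms by (cases as) auto

lemma cf_value_eq_1:
  assumes "as \<noteq> []" "\<forall>a\<in>set as. 0 < a" "cf_value as = 1"
  shows "as = [1]"
proof (cases as)
  case (Cons a as')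
  show ?thesis
  proof (cases "as' = []")
    case False
    have "1 \<le> cf_value as'" using False assms Cons by (intro cf_value_ge_1) auto
    then have "0 < 1 / cf_value as'" by simp
    moreover have "(1::rat) \<le> of_nat a" using assms Cons by (simp add: Suc_le_eq)
    moreover have "of_nat a + 1 / cf_value as' = 1"
      using assms(3) Cons False by (simp only: cf_value_Cons not_False_eq_True)
    ultimately have False by linarith
    then show ?thesis ..
  qed (use assms Cons in auto)
qed (use assms in auto)

lemma rat_nat_plus_unit_unique:
  fixes u v :: rat
  assumes "of_nat a + u = of_nat b + v" "0 < u" "u \<le> 1" "0 < v" "v \<le> 1"
  shows "a = b \<and> u = v"
proof -
  have "\<not> c < d" if "of_nat c + w = of_nat d + z" "w \<le> 1" "0 < z" for c d and w z :: rat
  proof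
    assume "c < d"
    then have "of_nat (Suc c) \<le> (of_nat d :: rat)" by (intro of_nat_mono) auto
    then show False using that by simp
  qed
  from this[of a u b v] this[of b v a u] assms have "a = b" by simp
  with assms(1) have "u = v" by auto
  with \<open>a = b\<close> show ?thesis ..
qed

definition cf_twin :: "nat list \<Rightarrow> nat list \<Rightarrow> bool" where
  "cf_twin as bs \<longleftrightarrow> (\<exists>cs a. 0 < a \<and> as = cs @ [a, 1] \<and> bs = cs @ [Suc a])"

lemma cf_twin_Cons: "cf_twin as bs \<Longrightarrow> cf_twin (a # as) (a # bs)"
  unfolding cf_twin_def by (metis append_Cons)

lemma cf_singleton_twin:
  assumes "bs \<noteq> []" "\<forall>b\<in>set (b # bs). 0 < b" "cf_value (b # bs) = of_nat a"
  shows "cf_twin (b # bs) [a]"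
proof -
  have "1 \<le> cf_value bs" using assms by (intro cf_value_ge_1) auto
  moreover from this have "0 < 1 / cf_value bs" "1 / cf_value bs \<le> 1" by auto
  moreover have eq: "of_nat b + 1 / cf_value bs = (of_nat a :: rat)"
    using assms by (simp add: cf_value_Cons)
  then have "0 < a" using \<open>0 < 1 / cf_value bs\<close>
    by (metis add_nonneg_pos not_gr_zero of_nat_0 of_nat_0_le_iff order_less_irrefl)
  then obtain a' where a': "a = Suc a'" by (cases a) auto
  moreover from eq a' have "of_nat b + 1 / cf_value bs = of_nat a' + 1" by simp
  ultimately have "b = a' \<and> 1 / cf_value bs = 1"
    by (intro rat_nat_plus_unit_unique) (assumption | rule zero_less_one order_refl)+
  moreover from this have "bs = [1]" using assms by (intro cf_value_eq_1) auto
  ultimately show ?thesis using a' assms unfolding cf_twin_def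
    by (intro exI[of _ "[]"] exI[of _ a']) auto
qed

lemma cf_unique:
  assumes "as \<noteq> []" "bs \<noteq> []" "\<forall>a\<in>set as. 0 < a" "\<forall>b\<in>set bs. 0 < b"
    and "cf_value as = cf_value bs"
  shows "as = bs \<or> cf_twin as bs \<or> cf_twin bs as"
  using assms
proof (induction as arbitrary: bs)
  case (Cons a as)
  then obtain b bs' where bs: "bs = b # bs'" by (cases bs) auto
  consider "as = []" "bs' = []" | "as = []" "bs' \<noteq> []" | "as \<noteq> []" "bs' = []"
    | "as \<noteq> []" "bs' \<noteq> []" by blast
  then show ?case
  proof cases
    case 4
    have ge: "1 \<le> cf_value as" "1 \<le> cf_value bs'"
      using 4 bs Cons.prems by (auto intro!: cf_value_ge_1)
    have "of_nat a + 1 / cf_value as = of_nat b + 1 / cf_value bs'"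
      using 4 bs Cons.prems by (simp add: cf_value_Cons)
    then have "a = b \<and> 1 / cf_value as = 1 / cf_value bs'"
      by (rule rat_nat_plus_unit_unique) (use ge in auto)
    then have "a = b" "cf_value as = cf_value bs'" by auto
    then show ?thesis using Cons.IH[of bs'] Cons.prems 4 bs cf_twin_Cons by auto
  next
    case 2
    then have "cf_twin (b # bs') [a]"
      using bs Cons.prems by (intro cf_singleton_twin) auto
    then show ?thesis using 2 bs by simp
  next
    case 3
    then have "cf_twin (a # as) [b]"
      using bs Cons.prems by (intro cf_singleton_twin) auto
    then show ?thesis using 3 bs by simp
  qed (use bs Cons.prems in auto)
qed simp

lemma walk_Up: "walk (x, y) (replicate k Up) = map (\<lambda>k. (x, k)) [y..<Suc (y + k)]"
proof (induction k arbitrary: y)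
  case (Suc k)
  have "[y..<Suc (y + Suc k)] = y # [Suc y..<Suc (Suc y + k)]"
    by (simp add: upt_conv_Cons del: upt_Suc)
  then show ?case using Suc by (simp del: upt_Suc)
qed simp

lemma border_strip_cong:
  assumes "cf_twin as bs"
  shows "border_strip as = border_strip bs"
proof -
  from assms obtain cs a where *: "0 < a" "as = cs @ [a, 1]" "bs = cs @ [Suc a]"
    unfolding cf_twin_def by blast
  show ?thesis
  proof (cases "cs = []")
    case True
    then have "border_steps as = replicate (a - 1) Up"
      using * by (simp add: border_steps_def)
    then show ?thesis using * True walk_Up[of 0 0 "a - 1"] by (simp add: border_strip_def)
  next
    case False
    then have "border_steps as = border_steps bs"
      using * by (auto simp: border_steps_def nth_append intro!: arg_cong[of _ _ concat])
    then show ?thesis using False * by (simp add: border_strip_def)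
  qed
qed

lemma border_strip_of_eq:
  assumes "is_cf x as"
  shows "border_strip_of x = border_strip as"
proof -
  define bs where "bs = (SOME bs. is_cf x bs)"
  have "is_cf x bs" unfolding bs_def using assms by (rule someI)
  then have "bs = as \<or> cf_twin bs as \<or> cf_twin as bs"
    using assms by (intro cf_unique) (auto simp: is_cf_def)
  then have "border_strip bs = border_strip as" using border_strip_cong by metis
  then show ?thesis by (simp add: border_strip_of_def bs_def)
qed

lemma is_cf_exists_nat:
  assumes "0 < q" "q \<le> p"
  shows "\<exists>as. is_cf (of_nat p / of_nat q) as"
  using assms
proof (induction q arbitrary: p rule: less_induct)
  case (less q)
  define c r where "c = p div q" and "r = p mod q"
  have c: "0 < c" using less.prems by (simp add: c_def div_greater_zero_iff)
  have "p = c * q + r" by (simp add: c_def r_def)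
  then have pq: "(of_nat p :: rat) / of_nat q = of_nat c + of_nat r / of_nat q"
    using less.prems by (simp add: field_simps)
  have rq: "r < q" using less.prems by (simp add: r_def)
  show ?case
  proof (cases "r = 0")
    case True
    then have "is_cf (of_nat p / of_nat q) [c]" using c pq by (simp add: is_cf_def)
    then show ?thesis by blast
  next
    case False
    then obtain as where "is_cf (of_nat q / of_nat r) as" using less.IH[of r q] rq by auto
    then have "is_cf (of_nat p / of_nat q) (c # as)"
      using c pq by (auto simp: is_cf_def cf_value_Cons)
    then show ?thesis by blast
  qed
qed

lemma is_cf_exists:
  assumes "1 \<le> x"
  shows "\<exists>as. is_cf x as"
proof -
  obtain p q where pq: "quotient_of x = (p, q)" by (cases "quotient_of x")
  have x: "x = of_int p / of_int q" and q: "0 < q"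
    using quotient_of_div[OF pq] quotient_of_denom_pos[OF pq] by auto
  from assms x q have "q \<le> p" by simp
  with q have "\<exists>as. is_cf (of_nat (nat p) / of_nat (nat q)) as"
    by (intro is_cf_exists_nat) auto
  then show ?thesis using x q \<open>q \<le> p\<close> by (simp add: of_nat_nat)
qed

text \<open>So the denominator of \<^const>\<open>higher_qcf\<close> never vanishes.\<close>

lemma Omega_nonzero: "Omega m i j bs \<noteq> 0"
proof -
  let ?P = "{\<sigma> \<in> p_partitions m (set bs).
              bs \<noteq> [] \<longrightarrow> \<sigma> (hd bs) \<le> m + 1 - i \<and> \<sigma> (last bs) \<le> m + 1 - j}"
  have "p_partitions m (set bs) \<subseteq> set bs \<rightarrow>\<^sub>E {0..m}" by (auto simp: p_partitions_def)
  then have "finite (p_partitions m (set bs))"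
    by (rule finite_subset) (intro finite_PiE; simp)
  then have fin: "finite ?P" by simp
  have "restrict (\<lambda>_. 0) (set bs) \<in> ?P" by (auto simp: p_partitions_def)
  with fin have "card ?P \<noteq> 0" by (subst card_0_eq) blast+
  moreover have "poly (Omega m i j bs) 1 = int (card ?P)"
    by (simp add: Omega_def poly_sum poly_monom)
  ultimately show ?thesis by force
qed

end

theory Submission
  imports Defs
begin

text \<open>Let \<open>f\<^sub>w(v)\<close> be the generating function of the fillings of the strip with step word \<open>w\<close> whose
  first box has value \<open>v\<close>. Prepending a step to \<open>w\<close> turns \<open>f\<^sub>w\<close> into its lower or upper partial
  sums, up to a power of \<open>q\<close>, so nonnegativity of the \<open>2 \<times> 2\<close> minors
  \<open>f\<^sub>w(j) f\<^sub>w\<^sub>'(i) - f\<^sub>w\<^sub>'(j) f\<^sub>w(i)\<close>, \<open>i < j\<close>, is inherited when the same step is prepended to both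
  words. On the other hand \<open>w\<close> is the Stern--Brocot address of the rational it represents, so the
  order of rationals is the lexicographic order of words with right \<open><\<close> end of word \<open><\<close> up, and at
  the first difference of two words the minors are nonnegative because lower sums increase and
  upper sums decrease. Summing minors gives the claim.\<close>

section \<open>Polynomials with nonnegative coefficients\<close>

definition nonneg_coeffs :: "'a::linordered_idom poly \<Rightarrow> bool" where
  "nonneg_coeffs p \<longleftrightarrow> (\<forall>k. 0 \<le> coeff p k)"

lemma nonneg_coeffs_monom: "0 \<le> c \<Longrightarrow> nonneg_coeffs (monom c n)"
  by (simp add: nonneg_coeffs_def)

lemma nonneg_coeffs_add: "nonneg_coeffs p \<Longrightarrow> nonneg_coeffs r \<Longrightarrow> nonneg_coeffs (p + r)"
  by (simp add: nonneg_coeffs_def)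

lemma nonneg_coeffs_mult: "nonneg_coeffs p \<Longrightarrow> nonneg_coeffs r \<Longrightarrow> nonneg_coeffs (p * r)"
  by (auto simp: nonneg_coeffs_def coeff_mult intro!: sum_nonneg mult_nonneg_nonneg)

lemma nonneg_coeffs_sum: "(\<And>a. a \<in> A \<Longrightarrow> nonneg_coeffs (f a)) \<Longrightarrow> nonneg_coeffs (sum f A)"
  by (auto simp: nonneg_coeffs_def coeff_sum intro!: sum_nonneg)

lemma nonneg_coeffs_sum_diff:
  assumes "finite B" "A \<subseteq> B" "\<And>a. a \<in> B - A \<Longrightarrow> nonneg_coeffs (f a)"
  shows "nonneg_coeffs (sum f B - sum f A)"
  using assms by (simp add: sum_diff[symmetric]) (rule nonneg_coeffs_sum, simp)

text \<open>Minors are bilinear, so a minor of sums is the sum of the minors of the terms.\<close>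

lemma nonneg_coeffs_sum_minor:
  fixes f g :: "'b \<Rightarrow> 'a::linordered_idom poly"
  assumes "\<And>a b. a \<in> A \<Longrightarrow> b \<in> B \<Longrightarrow> nonneg_coeffs (f b * g a - g b * f a)"
  shows "nonneg_coeffs (sum f B * sum g A - sum g B * sum f A)"
proof -
  have "sum f B * sum g A - sum g B * sum f A = (\<Sum>b\<in>B. \<Sum>a\<in>A. f b * g a - g b * f a)"
    by (simp add: sum_product sum_subtractf)
  then show ?thesis using assms by (simp add: nonneg_coeffs_sum)
qed

text \<open>The products over \<open>{..i} \<times> {..i}\<close> cancel, which leaves only minors
  with \<open>a \<le> i < b\<close>.\<close>

lemma nonneg_coeffs_atMost_minor:
  fixes f g :: "nat \<Rightarrow> 'a::linordered_idom poly"
  assumes "\<And>a b. a < b \<Longrightarrow> b \<le> j \<Longrightarrow> nonneg_coeffs (f b * g a - g b * f a)" "i \<le> j"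
  shows "nonneg_coeffs (sum f {..j} * sum g {..i} - sum g {..j} * sum f {..i})"
proof -
  have "sum h {..j} = sum h {..i} + sum h {i<..j}" for h :: "nat \<Rightarrow> 'a poly"
    using \<open>i \<le> j\<close> by (subst sum.union_disjoint[symmetric]) (auto intro!: sum.cong)
  then have "sum f {..j} * sum g {..i} - sum g {..j} * sum f {..i}
      = sum f {i<..j} * sum g {..i} - sum g {i<..j} * sum f {..i}"
    by (simp add: algebra_simps)
  then show ?thesis using assms by (auto intro!: nonneg_coeffs_sum_minor)
qed

text \<open>Here the common block is \<open>{j..m}\<close>, and minors with
  \<open>a < j \<le> b\<close> remain.\<close>

lemma nonneg_coeffs_atLeast_minor:
  fixes f g :: "nat \<Rightarrow> 'a::linordered_idom poly"
  assumes "\<And>a b. a < b \<Longrightarrow> b \<le> m \<Longrightarrow> nonneg_coeffs (f b * g a - g b * f a)" "i \<le> j" "j \<le> m"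
  shows "nonneg_coeffs (sum f {j..m} * sum g {i..m} - sum g {j..m} * sum f {i..m})"
proof -
  have "sum h {i..m} = sum h {i..<j} + sum h {j..m}" for h :: "nat \<Rightarrow> 'a poly"
    using assms(2,3) by (subst sum.union_disjoint[symmetric]) (auto intro!: sum.cong)
  then have "sum f {j..m} * sum g {i..m} - sum g {j..m} * sum f {i..m}
      = sum f {j..m} * sum g {i..<j} - sum g {j..m} * sum f {i..<j}"
    by (simp add: algebra_simps)
  then show ?thesis using assms by (auto intro!: nonneg_coeffs_sum_minor)
qed

section \<open>Step words\<close>

text \<open>This is \<open>f\<^sub>w(v)\<close> of the overview in recursive form;
  \<open>filling_sum_eq_path_gf\<close> ties it to fillings.\<close>

fun path_gf :: "nat \<Rightarrow> step list \<Rightarrow> nat \<Rightarrow> int poly" where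
  "path_gf m [] v = monom 1 v"
| "path_gf m (Up # w) v = monom 1 v * (\<Sum>u\<le>v. path_gf m w u)"
| "path_gf m (Rgt # w) v = monom 1 v * (\<Sum>u=v..m. path_gf m w u)"

text \<open>The empty word is the single box, the strip of 2. Written as \<open>1 + 1 / z\<close>, a
  value passes through a right step by \<open>z \<mapsto> z + 1\<close>. On values above 1 both
  steps are increasing maps, with up landing above 2 and right below 2.\<close>

fun word_value :: "step list \<Rightarrow> rat" where
  "word_value [] = 2"
| "word_value (Up # w) = word_value w + 1"
| "word_value (Rgt # w) = 2 - 1 / word_value w"

lemma word_value_gt_1: "1 < word_value w"
  by (induction w rule: word_value.induct) (simp_all add: field_simps)

lemma nonneg_coeffs_path_gf: "nonneg_coeffs (path_gf m w v)"
  by (induction m w v rule: path_gf.induct)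
    (auto intro!: nonneg_coeffs_monom nonneg_coeffs_mult nonneg_coeffs_sum)

lemma nonneg_coeffs_minor_scale:
  fixes c d :: "'a::linordered_idom poly"
  assumes "nonneg_coeffs c" "nonneg_coeffs d" "nonneg_coeffs (a * b - a' * b')"
  shows "nonneg_coeffs ((c * a) * (d * b) - (c * a') * (d * b'))"
proof -
  have "(c * a) * (d * b) - (c * a') * (d * b') = c * d * (a * b - a' * b')"
    by (simp add: algebra_simps)
  then show ?thesis using assms by (simp only: nonneg_coeffs_mult)
qed

text \<open>Both maps in \<open>word_value\<close> are strictly increasing, so equal first steps
  pass the hypothesis on to the tails; otherwise comparison with 2 limits the possible first
  steps.\<close>

lemma path_gf_minor:
  assumes "word_value w' < word_value w" "i < j" "j \<le> m"
  shows "nonneg_coeffs (path_gf m w j * path_gf m w' i - path_gf m w' j * path_gf m w i)"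
  using assms
proof (induction w arbitrary: w' i j)
  case Nil
  \<comment> \<open>The empty word has value 2, so \<open>w'\<close> has value below 2 and must
    start with a right step.\<close>
  then obtain u where w': "w' = Rgt # u"
    using word_value_gt_1[of "tl w'"] by (cases w' rule: word_value.cases) auto
  have "nonneg_coeffs (1 * (\<Sum>a=i..m. path_gf m u a) - (\<Sum>a=j..m. path_gf m u a) * 1)"
    using Nil by (auto intro!: nonneg_coeffs_sum_diff nonneg_coeffs_path_gf)
  then show ?case
    using nonneg_coeffs_minor_scale[of "monom 1 j" "monom 1 i"
        1 "\<Sum>a=i..m. path_gf m u a" "\<Sum>a=j..m. path_gf m u a" 1] w'
    by (simp add: nonneg_coeffs_monom)
next
  case (Cons s w)
  define L where "L u v = (\<Sum>a\<le>v. path_gf m u a)" for u v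
  define H where "H u v = (\<Sum>a=v..m. path_gf m u a)" for u v
  have nn: "nonneg_coeffs (L u v)" "nonneg_coeffs (H u v)" for u v
    unfolding L_def H_def by (auto intro!: nonneg_coeffs_sum nonneg_coeffs_path_gf)
  have L: "nonneg_coeffs (L u j - L u i)" for u
    unfolding L_def using Cons.prems by (auto intro!: nonneg_coeffs_sum_diff nonneg_coeffs_path_gf)
  have H: "nonneg_coeffs (H u i - H u j)" for u
    unfolding H_def using Cons.prems by (auto intro!: nonneg_coeffs_sum_diff nonneg_coeffs_path_gf)
  \<comment> \<open>Each \<open>path_gf\<close> carries its own power of \<open>q\<close>, so every
    minor has the common factor \<open>q^(i+j)\<close>; \<open>scale\<close> restores it.\<close>
  note scale = nonneg_coeffs_minor_scale[OF nonneg_coeffs_monom nonneg_coeffs_monom,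
      of 1 1 _ _ _ _ j i, simplified]
  note gt = word_value_gt_1[of w] word_value_gt_1[of "tl w'"]
  show ?case
  proof (cases s)
    case Up
    show ?thesis
    proof (cases w' rule: word_value.cases)
      case 1
      have "nonneg_coeffs (L w j * 1 - 1 * L w i)" using L by simp
      from scale[OF this] show ?thesis using Up 1 by (simp add: L_def)
    next
      case (2 u)
      have "nonneg_coeffs (L w j * L u i - L u j * L w i)"
        unfolding L_def using Cons Up 2 by (intro nonneg_coeffs_atMost_minor Cons.IH) auto
      from scale[OF this] show ?thesis using Up 2 by (simp add: L_def)
    next
      case (3 u)
      \<comment> \<open>The term \<open>L w i * H u i\<close> is inserted to separate the growth of
        \<open>L\<close> from the decrease of \<open>H\<close>.\<close>
      have "L w j * H u i - H u j * L w i = (L w j - L w i) * H u i + L w i * (H u i - H u j)"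
        by (simp add: algebra_simps)
      also have "nonneg_coeffs \<dots>"
        using nn L H by (intro nonneg_coeffs_add nonneg_coeffs_mult)
      finally show ?thesis using scale Up 3 by (simp add: L_def H_def)
    qed
  next
    case Rgt
    then have lt: "word_value w' < 2 - 1 / word_value w" using Cons.prems by simp
    have "0 < 1 / word_value w" using gt by simp
    with lt have "word_value w' < 2" by linarith
    then obtain u where w': "w' = Rgt # u"
      using gt by (cases w' rule: word_value.cases) auto
    have "word_value u < word_value w"
      using lt gt w' by (simp add: field_simps)
    then have "nonneg_coeffs (H w j * H u i - H u j * H w i)"
      unfolding H_def using Cons by (intro nonneg_coeffs_atLeast_minor Cons.IH) auto
    from scale[OF this] show ?thesis using Rgt w' by (simp add: H_def)
  qed
qed

section \<open>Border strips as words\<close>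

text \<open>Only the last block is shortened, unlike in \<open>border_steps\<close>, so that tails
  are again of this form with \<open>s\<close> and \<open>t\<close> exchanged.\<close>

fun cf_steps :: "step \<Rightarrow> step \<Rightarrow> nat list \<Rightarrow> step list" where
  "cf_steps s t [] = []"
| "cf_steps s t [a] = replicate (a - 1) s"
| "cf_steps s t (a # b # as) = replicate a s @ cf_steps t s (b # as)"

lemma cf_steps_eq_concat:
  "cf_steps s t as = concat (map
     (\<lambda>k. replicate (if Suc k = length as then as ! k - 1 else as ! k) (if even k then s else t))
     [0..<length as])"
proof (induction s t as rule: cf_steps.induct)
  case (3 s t a b as)
  show ?case
    unfolding cf_steps.simps 3 list.size(4) add_Suc_right add_0_right Groups.add_0_right
    by (subst (2) map_upt_Suc) (auto simp del: upt_Suc intro!: arg_cong[of _ _ concat])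
qed auto

lemma border_steps_eq_cf_steps:
  "border_steps (a # b # as) = replicate (a - 1) Up @ cf_steps Rgt Up (b # as)"
  unfolding border_steps_def cf_steps_eq_concat list.size(4) add_Suc_right
  by (subst map_upt_Suc) (auto simp del: upt_Suc intro!: arg_cong[of _ _ concat])

lemma word_value_replicate_Up: "word_value (replicate k Up @ w) = of_nat k + word_value w"
  by (induction k) simp_all

lemma word_value_replicate_Rgt:
  assumes "word_value w = 1 + 1 / z" "0 < z"
  shows "word_value (replicate k Rgt @ w) = 1 + 1 / (of_nat k + z)"
proof (induction k)
  case (Suc k)
  have "0 < of_nat k + z" using assms by (simp add: add_nonneg_pos)
  then have "2 - 1 / (1 + 1 / (of_nat k + z)) = 1 + 1 / (of_nat (Suc k) + z)"
    by (simp add: field_simps)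
  then show ?case by (simp only: replicate_Suc append_Cons word_value.simps Suc)
qed (use assms in simp)

text \<open>The claims are proved together because removing a block exchanges up and right. The
  summand 1 in the first claim reflects the unshortened first block.\<close>

lemma word_value_cf_steps:
  assumes "as \<noteq> []" "\<forall>a\<in>set as. 0 < a"
  shows "word_value (cf_steps Up Rgt as) = 1 + cf_value as"
    and "word_value (cf_steps Rgt Up as) = 1 + 1 / cf_value as"
  using assms
proof (induction as rule: cf_value.induct)
  case (2 a)
  {
    case 1
    then show ?case using word_value_replicate_Up[of "a - 1" "[]"] by (simp add: of_nat_diff)
  next
    case 2
    then show ?case
      \<comment> \<open>The value 2 of the empty word is \<open>1 + 1 / z\<close> at
        \<open>z = 1\<close>.\<close>
      using word_value_replicate_Rgt[of "[]" 1 "a - 1"] by (simp add: of_nat_diff)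
  }
next
  case (3 a b as)
  {
    case 1
    then show ?case using 3 by (simp add: word_value_replicate_Up)
  next
    case 2
    then have "1 \<le> cf_value (b # as)" by (intro cf_value_ge_1) auto
    then show ?case
      using 2 3 word_value_replicate_Rgt[of "cf_steps Up Rgt (b # as)" "1 / cf_value (b # as)" a]
      by simp
  }
qed simp_all

lemma border_strip_of_eq_walk:
  assumes "1 < x"
  shows "\<exists>w. border_strip_of x = walk (0, 0) w \<and> word_value w = x"
proof -
  obtain as where as: "is_cf x as" using is_cf_exists[of x] assms by auto
  have "\<exists>a b bs. is_cf x (a # b # bs)"
  proof (cases as rule: cf_value.cases)
    case (2 a)
    \<comment> \<open>A one-entry expansion has \<open>a \<ge> 2\<close> because
      \<open>1 < x\<close>, so it can be split to reach the branch of \<open>border_strip\<close>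
      that uses \<open>walk\<close>.\<close>
    then have "is_cf x [a - 1, 1]" using as assms by (auto simp: is_cf_def of_nat_diff)
    then show ?thesis by blast
  qed (use as in \<open>auto simp: is_cf_def\<close>)
  then obtain a b bs where cf: "is_cf x (a # b # bs)" by blast
  then have "word_value (border_steps (a # b # bs)) = x"
    by (simp add: is_cf_def border_steps_eq_cf_steps word_value_replicate_Up word_value_cf_steps
        of_nat_diff)
  moreover have "border_strip_of x = walk (0, 0) (border_steps (a # b # bs))"
    using border_strip_of_eq[OF cf] by (simp add: border_strip_def)
  ultimately show ?thesis by blast
qed

lemma border_strip_of_1: "border_strip_of 1 = []"
  using border_strip_of_eq[of 1 "[1]"] by (simp add: is_cf_def border_strip_def)

section \<open>Fillings of a walk\<close>

text \<open>Here \<open>v\<close> sits on a box and \<open>u\<close> on its successor; values fall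
  along an up step since columns increase downwards.\<close>

fun step_ok :: "step \<Rightarrow> nat \<Rightarrow> nat \<Rightarrow> bool" where
  "step_ok Up v u \<longleftrightarrow> u \<le> v"
| "step_ok Rgt v u \<longleftrightarrow> v \<le> u"

lemma walk_neq_Nil [simp]: "walk b w \<noteq> []"
  by (cases w) auto

lemma hd_walk [simp]: "hd (walk b w) = b"
  by (cases w) auto

lemma start_in_walk [simp]: "b \<in> set (walk b w)"
  by (cases w) auto

lemma walk_bounds: "(x', y') \<in> set (walk (x, y) w) \<Longrightarrow> x \<le> x' \<and> y \<le> y'"
proof (induction w arbitrary: x y)
  case (Cons s w)
  then show ?case by (cases s) (auto dest: Cons.IH)
qed simp

lemma start_notin_walk_move: "b \<notin> set (walk (move s b) w)"
  by (cases b; cases s) (auto dest: walk_bounds)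

lemma p_partitions_PiE: "\<sigma> \<in> p_partitions m G \<Longrightarrow> \<sigma> \<in> G \<rightarrow>\<^sub>E {0..m}"
  by (simp add: p_partitions_def)

lemma finite_p_partitions: "finite G \<Longrightarrow> finite (p_partitions m G)"
  by (rule finite_subset[of _ "G \<rightarrow>\<^sub>E {0..m}"]) (auto simp: p_partitions_def intro: finite_PiE)

lemma p_partitions_row:
  "\<sigma> \<in> p_partitions m G \<Longrightarrow> (x, y) \<in> G \<Longrightarrow> (x', y) \<in> G \<Longrightarrow> x \<le> x' \<Longrightarrow> \<sigma> (x, y) \<le> \<sigma> (x', y)"
  by (auto simp: p_partitions_def)

lemma p_partitions_col:
  "\<sigma> \<in> p_partitions m G \<Longrightarrow> (x, y) \<in> G \<Longrightarrow> (x, y') \<in> G \<Longrightarrow> y \<le> y' \<Longrightarrow> \<sigma> (x, y') \<le> \<sigma> (x, y)"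
  by (auto simp: p_partitions_def)

text \<open>All later boxes lie weakly above and to the right of the successor of \<open>b\<close>,
  so by transitivity the conditions on \<open>b\<close> reduce to the one between \<open>b\<close>
  and its successor.\<close>

lemma p_partitions_walk_Cons:
  assumes "v \<le> m"
  shows "{\<sigma> \<in> p_partitions m (set (walk b (s # w))). \<sigma> b = v}
       = (\<lambda>\<tau>. \<tau>(b := v)) ` {\<tau> \<in> p_partitions m (set (walk (move s b) w)). step_ok s v (\<tau> (move s b))}"
    (is "?L = ?F ` ?R")
proof -
  define G where "G = set (walk (move s b) w)"
  have G: "set (walk b (s # w)) = insert b G" by (simp add: G_def)
  have bG: "b \<notin> G" and cG: "move s b \<in> G" by (simp_all add: G_def start_notin_walk_move)
  obtain x y where b: "b = (x, y)" by (cases b)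
  have bounds: "case s of Up \<Rightarrow> x \<le> x' \<and> Suc y \<le> y' | Rgt \<Rightarrow> Suc x \<le> x' \<and> y \<le> y'"
    if "(x', y') \<in> G" for x' y'
    using that unfolding G_def b by (cases s) (auto dest!: walk_bounds)
  show ?thesis
  proof (intro equalityI subsetI)
    fix \<sigma> assume "\<sigma> \<in> ?L"
    then have \<sigma>: "\<sigma> \<in> p_partitions m (insert b G)" "\<sigma> b = v" unfolding G by blast+
    define \<tau> where "\<tau> = restrict \<sigma> G"
    have "\<tau> \<in> p_partitions m G"
      using \<sigma>(1) by (auto simp: p_partitions_def \<tau>_def)
    moreover have "step_ok s v (\<tau> (move s b))"
      using \<sigma> cG p_partitions_row[OF \<sigma>(1), of x y "Suc x"] p_partitions_col[OF \<sigma>(1), of x y "Suc y"]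
      by (cases s) (auto simp: \<tau>_def b)
    moreover have "\<sigma> = ?F \<tau>"
    proof
      fix z show "\<sigma> z = ?F \<tau> z"
        \<comment> \<open>Off the strip both sides are \<open>undefined\<close>.\<close>
        using \<sigma>(2) PiE_arb[OF p_partitions_PiE[OF \<sigma>(1)], of z] by (auto simp: \<tau>_def)
    qed
    ultimately show "\<sigma> \<in> ?F ` ?R" by (auto simp: G_def)
  next
    fix \<sigma> assume "\<sigma> \<in> ?F ` ?R"
    then obtain \<tau> where \<tau>: "\<tau> \<in> p_partitions m G" "step_ok s v (\<tau> (move s b))" "\<sigma> = ?F \<tau>"
      by (auto simp: G_def)
    have row: "v \<le> \<tau> (x', y)" if "(x', y) \<in> G" for x'
      using bounds[OF that] p_partitions_row[OF \<tau>(1) _ that, of "Suc x"] \<tau>(2) cG b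
      by (cases s) auto
    have col: "\<tau> (x, y') \<le> v" if "(x, y') \<in> G" for y'
      using bounds[OF that] p_partitions_col[OF \<tau>(1) _ that, of "Suc y"] \<tau>(2) cG b
      by (cases s) auto
    have below: "x \<le> x' \<and> y \<le> y'" if "(x', y') \<in> G" for x' y'
      using bounds[OF that] by (cases s) auto
    have "\<sigma> \<in> insert b G \<rightarrow>\<^sub>E {0..m}"
      using p_partitions_PiE[OF \<tau>(1)] assms by (auto simp: \<tau>(3) PiE_def extensional_def)
    moreover have "\<sigma> (x1, y1) \<le> \<sigma> (x2, y1)"
      if "(x1, y1) \<in> insert b G" "(x2, y1) \<in> insert b G" "x1 \<le> x2" for x1 x2 y1
      using that row p_partitions_row[OF \<tau>(1), of x1 y1 x2] below[of x1 y1] bG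
      by (auto simp: \<tau>(3) b)
    moreover have "\<sigma> (x1, y2) \<le> \<sigma> (x1, y1)"
      if "(x1, y1) \<in> insert b G" "(x1, y2) \<in> insert b G" "y1 \<le> y2" for x1 y1 y2
      using that col p_partitions_col[OF \<tau>(1), of x1 y1 y2] below[of x1 y1] bG
      by (auto simp: \<tau>(3) b)
    ultimately have "\<sigma> \<in> p_partitions m (insert b G)"
      unfolding p_partitions_def by blast
    then show "\<sigma> \<in> ?L" unfolding G by (simp add: \<tau>(3))
  qed
qed

definition filling_weight :: "box set \<Rightarrow> (box \<Rightarrow> nat) \<Rightarrow> int poly" where
  "filling_weight G \<sigma> = monom 1 (\<Sum>b\<in>G. \<sigma> b)"

lemma sum_by_start_value:
  fixes h :: "(box \<Rightarrow> nat) \<Rightarrow> 'a::comm_monoid_add"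
  assumes "finite V"
  shows "(\<Sum>\<sigma> \<in> {\<sigma> \<in> p_partitions m (set bs). \<sigma> b \<in> V}. h \<sigma>)
       = (\<Sum>v\<in>V. \<Sum>\<sigma> \<in> {\<sigma> \<in> p_partitions m (set bs). \<sigma> b = v}. h \<sigma>)"
proof -
  have "(\<Sum>v\<in>V. sum h {\<sigma> \<in> {\<sigma> \<in> p_partitions m (set bs). \<sigma> b \<in> V}. \<sigma> b = v})
      = sum h {\<sigma> \<in> p_partitions m (set bs). \<sigma> b \<in> V}"
    using assms by (intro sum.group) (auto simp: finite_p_partitions)
  then show ?thesis by (auto intro!: sum.cong elim!: trans[OF sym])
qed

text \<open>Deleting the first box is a bijection onto the fillings of the shorter strip whose first
  value is admissible next to \<open>v\<close>, and it divides the weight by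
  \<open>q^v\<close>.\<close>

lemma filling_sum_eq_path_gf:
  assumes "v \<le> m"
  shows "(\<Sum>\<sigma> \<in> {\<sigma> \<in> p_partitions m (set (walk b w)). \<sigma> b = v}. filling_weight (set (walk b w)) \<sigma>)
       = path_gf m w v"
  using assms
proof (induction w arbitrary: b v)
  case Nil
  have "{\<sigma> \<in> p_partitions m {b}. \<sigma> b = v} = {(\<lambda>z. undefined)(b := v)}"
    using Nil by (auto simp: p_partitions_def PiE_def extensional_def fun_eq_iff)
  then show ?case by (simp add: filling_weight_def)
next
  case (Cons s w)
  define c where "c = move s b"
  define G where "G = set (walk c w)"
  have bG: "b \<notin> G" by (simp add: G_def c_def start_notin_walk_move)
  define R where "R = {\<tau> \<in> p_partitions m G. step_ok s v (\<tau> c)}"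
  have inj: "inj_on (\<lambda>\<tau>. \<tau>(b := v)) R"
  proof (rule inj_onI)
    fix \<tau> \<rho> assume "\<tau> \<in> R" "\<rho> \<in> R" and eq: "\<tau>(b := v) = \<rho>(b := v)"
    \<comment> \<open>Both fillings are \<open>undefined\<close> at \<open>b\<close>, which lies
      outside \<open>G\<close>.\<close>
    then have "\<tau> b = \<rho> b" using bG by (auto simp: R_def dest!: p_partitions_PiE PiE_arb)
    with eq show "\<tau> = \<rho>" by (metis fun_upd_triv fun_upd_upd)
  qed
  have weight: "filling_weight (insert b G) (\<tau>(b := v)) = monom 1 v * filling_weight G \<tau>" for \<tau>
  proof -
    have "(\<Sum>z\<in>G. (\<tau>(b := v)) z) = (\<Sum>z\<in>G. \<tau> z)" using bG by (intro sum.cong) auto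
    then show ?thesis using bG by (simp add: filling_weight_def mult_monom G_def)
  qed
  define V where "V = (case s of Up \<Rightarrow> {..v} | Rgt \<Rightarrow> {v..m})"
  have "\<tau> c \<le> m" if "\<tau> \<in> p_partitions m G" for \<tau>
    using PiE_mem[OF p_partitions_PiE[OF that], of c] by (simp add: G_def)
  then have R: "R = {\<tau> \<in> p_partitions m G. \<tau> c \<in> V}"
    by (cases s) (auto simp: R_def V_def)
  have V: "finite V" "\<And>u. u \<in> V \<Longrightarrow> u \<le> m"
    using Cons.prems by (cases s; auto simp: V_def)+
  have "(\<Sum>\<sigma> \<in> {\<sigma> \<in> p_partitions m (set (walk b (s # w))). \<sigma> b = v}.
          filling_weight (set (walk b (s # w))) \<sigma>)
      = (\<Sum>\<sigma> \<in> (\<lambda>\<tau>. \<tau>(b := v)) ` R. filling_weight (insert b G) \<sigma>)"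
    unfolding p_partitions_walk_Cons[OF Cons.prems] by (simp add: R_def G_def c_def)
  also have "\<dots> = monom 1 v * (\<Sum>\<tau>\<in>R. filling_weight G \<tau>)"
    by (simp only: sum.reindex[OF inj] o_def weight sum_distrib_left)
  also have "(\<Sum>\<tau>\<in>R. filling_weight G \<tau>) = (\<Sum>u\<in>V. path_gf m w u)"
    unfolding R G_def sum_by_start_value[OF V(1)] using V(2) by (intro sum.cong Cons.IH) auto
  finally show ?case by (cases s) (simp_all add: V_def)
qed

text \<open>For \<open>j = 1\<close> the bound on the last box is \<open>m\<close>, hence automatic,
  and the bound on the first box is \<open>m + 1 - (m + 1 - i) = i\<close>.\<close>

lemma Omega_walk:
  assumes "i \<le> m"
  shows "Omega m (m + 1 - i) 1 (walk b w) = (\<Sum>v\<le>i. path_gf m w v)"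
proof -
  have last: "\<sigma> (last (walk b w)) \<le> m" if "\<sigma> \<in> p_partitions m (set (walk b w))" for \<sigma>
    using PiE_mem[OF p_partitions_PiE[OF that], of "last (walk b w)"] by simp
  have "Omega m (m + 1 - i) 1 (walk b w)
      = (\<Sum>\<sigma> \<in> {\<sigma> \<in> p_partitions m (set (walk b w)). \<sigma> b \<in> {..i}}.
          filling_weight (set (walk b w)) \<sigma>)"
    unfolding Omega_def filling_weight_def using assms last by (intro sum.cong) auto
  also have "\<dots> = (\<Sum>v\<le>i. path_gf m w v)"
    unfolding sum_by_start_value[OF finite_atMost]
    using assms by (intro sum.cong filling_sum_eq_path_gf) auto
  finally show ?thesis .
qed

lemma Omega_Nil: "Omega m i j [] = 1"
  by (simp add: Omega_def p_partitions_def)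

theorem theoremC:
  fixes m i :: nat and x y :: rat and R S A B :: "int poly"
  assumes "1 \<le> m" and "i \<le> m"
    and "y < x" and "1 \<le> y"
    and "R = Omega m (m + 1 - i) 1 (border_strip_of x)"
    and "S = Omega m (m + 1) 1 (border_strip_of x)"
    and "A = Omega m (m + 1 - i) 1 (border_strip_of y)"
    and "B = Omega m (m + 1) 1 (border_strip_of y)"
  shows "higher_qcf i m x = Fraction_Field.Fract R S \<and>
         higher_qcf i m y = Fraction_Field.Fract A B \<and>
         (\<forall>k. 0 \<le> coeff (R * B - A * S) k)"
proof -
  obtain w where w: "border_strip_of x = walk (0, 0) w" "word_value w = x"
    using border_strip_of_eq_walk[of x] assms by auto
  \<comment> \<open>The denominator is the case \<open>i = 0\<close> of the numerator.\<close>
  have R: "R = (\<Sum>v\<le>i. path_gf m w v)" and S: "S = (\<Sum>v\<le>0. path_gf m w v)"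
    using assms(2,5,6) w Omega_walk[of i m] Omega_walk[of 0 m] by simp_all
  have "nonneg_coeffs (R * B - A * S)"
  proof (cases "y = 1")
    case True
    then have "A = 1" "B = 1" using assms by (simp_all add: border_strip_of_1 Omega_Nil)
    moreover have "nonneg_coeffs (R - S)"
      unfolding R S by (intro nonneg_coeffs_sum_diff nonneg_coeffs_path_gf) auto
    ultimately show ?thesis by simp
  next
    case False
    then obtain w' where w': "border_strip_of y = walk (0, 0) w'" "word_value w' = y"
      using border_strip_of_eq_walk[of y] assms by auto
    have A: "A = (\<Sum>v\<le>i. path_gf m w' v)" and B: "B = (\<Sum>v\<le>0. path_gf m w' v)"
      using assms(2,7,8) w' Omega_walk[of i m] Omega_walk[of 0 m] by simp_all
    \<comment> \<open>The claim is now the minor of lower sums with bounds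
      \<open>0 \<le> i\<close>.\<close>
    show ?thesis unfolding R S A B
      using assms w w' by (intro nonneg_coeffs_atMost_minor path_gf_minor) auto
  qed
  then show ?thesis using assms by (simp add: higher_qcf_def nonneg_coeffs_def)
qed

end
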